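(* Consider the single-server queue with Markov-modulated arrival and service rates described in the context, parametrized by $\epsilon=1-\lambda/\mu$. Let $f:\mathcal Z\to\mathbb R$ be any function such that a solution $V_f$ to the Poisson equation for $f$ exists and satisfies $\mathbb E[|V_f(\widetilde Z)|^{1+\xi}]<\infty$ for some $\xi>0$. Then, for all $s>0$, as $\epsilon\downarrow0$, $$\mathrm{Cov}\left(e^{-s\epsilon\widetilde q},f(\widetilde Z)\right)=(e^{-s\epsilon}-1)\,\mathbb E\left[e^{-s\epsilon\widetilde q}\,V_f(\widetilde Z)\left(\lambda_{\widetilde Z}-\mu_{\widetilde Z}\right)\right]+O\left(\epsilon^{2-\frac1{1+\xi}}\right).$$
   Context: Modulating chain. $\{Z(t):t\ge0\}$ is an ergodic continuous-time Markov chain (CTMC) on a countable state space $\mathcal Z$ with transition rate matrix $[\alpha_{ii'}]_{i,i'\in\mathcal Z}$ and stationary distribution $\pi$; $\alpha_{i\bullet}:=\sum_{i'\ne i}\alpha_{ii'}$ and $\sup_i\alpha_{i\bullet}<\infty$. Single-server queue. Given nonnegative rates $\lambda_i,\mu_i$ ($i\in\mathcal Z$), the pair $(Z(t),q(t))$, with $q(t)\in\mathbb Z_+$ the number of jobs in the system, is a CTMC with the following transitions from state $(i,q)$: to $(i,q+1)$ at rate $\lambda_i$; to $(i,q-1)$ at rate $\mu_i$ if $q>0$; to $(i',q)$ at rate $\alpha_{ii'}$ for each $i'\ne i$. There are finite constants $\lambda_{\max},\mu_{\max}$ with $\lambda_i<\lambda_{\max}$, $\mu_i<\mu_{\max}$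 for all $i$. Heavy traffic. $\lambda:=\sum_i\pi_i\lambda_i$, $\mu:=\sum_i\pi_i\mu_i$, $\rho:=\lambda/\mu$, $\epsilon:=1-\rho$. We consider a family of systems indexed by small $\epsilon>0$ in which all $\mu_i$ and $\alpha_{ii'}$ are fixed and only the arrival rates $\lambda_i$ depend on $\epsilon$, with $\lambda=(1-\epsilon)\mu$; $\lambda_{\max}$ and $\mu_{\max}$ do not depend on $\epsilon$. For every such $\epsilon>0$, $(Z(t),q(t))$ is positive recurrent; $(\widetilde Z,\widetilde q)$ denotes a random element with its stationary distribution (so $\widetilde Z\sim\pi$), and $\mathbb E$, $\mathrm{Cov}$ are under this distribution. $O(\cdot)$ is as $\epsilon\downarrow0$ with $s$, $f$, $V_f$ fixed. Poisson equation. For $f:\mathcal Z\to\mathbb R$ with $\bar f=\mathbb E[f(\widetilde Z)]$, a solution to the Poisson equation for $f$ is a function $V_f:\mathcal Z\to\mathbb R$ with $$V_f(i)=\frac{f(i)-\bar f}{\alpha_{i\bullet}}+\sum_{i'\ne i}\frac{\alpha_{ii'}}{\alpha_{i\bullet}}V_f(i')\qquad\text{for all } i\in\mathcal Z.$$ *)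

theory Defs
  imports "HOL-Probability.Probability" "HOL-Library.Landau_Symbols"
begin

section \<open>Continuous-time Markov chains with given transition rates\<close>

text \<open>
  Rates are functions \<open>r i j\<close>; only off-diagonal entries matter, the diagonal of \<open>r\<close> is ignored.
\<close>

definition exit_rate :: "('s \<Rightarrow> 's \<Rightarrow> real) \<Rightarrow> 's \<Rightarrow> real" where
  "exit_rate r i = (\<Sum>\<^sub>\<infinity>j\<in>-{i}. r i j)"

text \<open>
  The conjunct on summability is needed because \<open>infsum\<close> is 0 on non-summable families.
\<close>

definition bounded_rates :: "('s \<Rightarrow> 's \<Rightarrow> real) \<Rightarrow> bool" where
  "bounded_rates r \<longleftrightarrow>
     (\<forall>i j. i \<noteq> j \<longrightarrow> 0 \<le> r i j) \<and>
     (\<forall>i. r i summable_on -{i}) \<and>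
     bdd_above (range (exit_rate r))"

definition generator :: "('s \<Rightarrow> 's \<Rightarrow> real) \<Rightarrow> 's \<Rightarrow> 's \<Rightarrow> real" where
  "generator r i j = (if i = j then - exit_rate r i else r i j)"

text \<open>
  \<open>P t i\<close> is the distribution at time \<open>t\<close> of the chain started in \<open>i\<close>. The last conjunct is
  \<open>P(X(t) = j | X(0) = i) = [i = j] + Q i j * t + o(t)\<close> with \<open>Q\<close> the generator.
\<close>

definition ctmc :: "('s \<Rightarrow> 's \<Rightarrow> real) \<Rightarrow> (real \<Rightarrow> 's \<Rightarrow> 's pmf) \<Rightarrow> bool" where
  "ctmc r P \<longleftrightarrow>
     (\<forall>i. P 0 i = return_pmf i) \<and>
     (\<forall>s\<ge>0. \<forall>t\<ge>0. \<forall>i. P (s + t) i = bind_pmf (P s i) (P t)) \<and>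
     (\<forall>i j. ((\<lambda>t. (pmf (P t i) j - pmf (P 0 i) j) / t) \<longlongrightarrow> generator r i j) (at_right 0))"

definition stationary :: "(real \<Rightarrow> 's \<Rightarrow> 's pmf) \<Rightarrow> 's pmf \<Rightarrow> bool" where
  "stationary P p \<longleftrightarrow> (\<forall>t\<ge>0. bind_pmf p (P t) = p)"

definition irreducible_chain :: "(real \<Rightarrow> 's \<Rightarrow> 's pmf) \<Rightarrow> bool" where
  "irreducible_chain P \<longleftrightarrow> (\<forall>i j. \<exists>t\<ge>0. pmf (P t i) j > 0)"

text \<open>
  \<open>L\<close> is the law, on right-continuous paths (discrete topology on the state space), of the chain
  with transition function \<open>P\<close> started in \<open>i\<close>. Path values at negative times play no role.
\<close>

definition ctmc_path_law ::
    "(real \<Rightarrow> 's \<Rightarrow> 's pmf) \<Rightarrow> 's \<Rightarrow> (real \<Rightarrow> 's) measure \<Rightarrow> bool" where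
  "ctmc_path_law P i L \<longleftrightarrow>
     prob_space L \<and>
     (\<forall>w\<in>space L. \<forall>t\<ge>0. \<forall>\<^sub>F u in at_right t. w u = w t) \<and>
     (\<forall>t\<ge>0. (\<lambda>w. w t) \<in> measurable L (count_space UNIV)) \<and>
     (\<forall>(t :: nat \<Rightarrow> real) x n. mono t \<and> t 0 = 0 \<and> x 0 = i \<longrightarrow>
        measure L {w \<in> space L. \<forall>k\<le>n. w (t k) = x k} =
        (\<Prod>k<n. pmf (P (t (Suc k) - t k) (x k)) (x (Suc k))))"

text \<open>First time the path is in \<open>i\<close> after having left \<open>i\<close>; infinite if there is none.\<close>

definition return_time :: "'s \<Rightarrow> (real \<Rightarrow> 's) \<Rightarrow> ennreal" where
  "return_time i w =
     Inf {ennreal t |t. 0 < t \<and> w t = i \<and> (\<exists>u. 0 < u \<and> u < t \<and> w u \<noteq> i)}"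

text \<open>
  Finite mean return time; as usual, an absorbing state counts as positive recurrent.
\<close>

definition positive_recurrent :: "(real \<Rightarrow> 's \<Rightarrow> 's pmf) \<Rightarrow> bool" where
  "positive_recurrent P \<longleftrightarrow>
     (\<forall>i. (\<forall>t\<ge>0. P t i = return_pmf i) \<or>
          (\<exists>L. ctmc_path_law P i L \<and> (\<integral>\<^sup>+w. return_time i w \<partial>L) < \<infinity>))"

text \<open>There is no periodicity in continuous time.\<close>

definition ergodic :: "(real \<Rightarrow> 's \<Rightarrow> 's pmf) \<Rightarrow> bool" where
  "ergodic P \<longleftrightarrow> irreducible_chain P \<and> positive_recurrent P"

section \<open>Markov-modulated single-server queue\<close>

fun queue_rates ::
    "('z \<Rightarrow> 'z \<Rightarrow> real) \<Rightarrow> ('z \<Rightarrow> real) \<Rightarrow> ('z \<Rightarrow> real) \<Rightarrow> 'z \<times> nat \<Rightarrow> 'z \<times> nat \<Rightarrow> real" where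
  "queue_rates \<alpha> lam mu (i, q) (i', q') =
     (if i' = i \<and> q' = q + 1 then lam i
      else if i' = i \<and> q > 0 \<and> q' = q - 1 then mu i
      else if i' \<noteq> i \<and> q' = q then \<alpha> i i'
      else 0)"

section \<open>Poisson equation and covariance\<close>

text \<open>
  Integrability of \<open>f\<close> and summability make the mean of \<open>f\<close> and the series meaningful; the
  library's integral and infinite sum are total functions.
\<close>

definition poisson_solution ::
    "('z \<Rightarrow> 'z \<Rightarrow> real) \<Rightarrow> 'z pmf \<Rightarrow> ('z \<Rightarrow> real) \<Rightarrow> ('z \<Rightarrow> real) \<Rightarrow> bool" where
  "poisson_solution \<alpha> p f V \<longleftrightarrow>
     integrable (measure_pmf p) f \<and>
     (\<forall>i. (\<lambda>i'. \<alpha> i i' / exit_rate \<alpha> i * V i') summable_on -{i} \<and>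
          V i = (f i - measure_pmf.expectation p f) / exit_rate \<alpha> i
                + (\<Sum>\<^sub>\<infinity>i'\<in>-{i}. \<alpha> i i' / exit_rate \<alpha> i * V i'))"

definition covariance :: "'a pmf \<Rightarrow> ('a \<Rightarrow> real) \<Rightarrow> ('a \<Rightarrow> real) \<Rightarrow> real" where
  "covariance p X Y =
     measure_pmf.expectation p
       (\<lambda>x. (X x - measure_pmf.expectation p X) * (Y x - measure_pmf.expectation p Y))"

end

theory Submission
  imports Defs
begin

text \<open>
  Stationarity of \<open>pq\<close> makes the mean drift of \<open>exp (- b * q) * V i\<close> vanish. By the Poisson
  equation the modulating part of this drift is \<open>- exp (- b * q) * (f i - mean f)\<close>, so the mean
  drift identity expresses the covariance through the arrival and service terms. Up to an error of
  order \<open>b\<^sup>2\<close> these give the main term, except that no service takes place at \<open>q = 0\<close>. The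
  rate of unused service equals \<open>mean mu - mean lam\<close>, which is of order \<open>\<epsilon>\<close>, and Hoelder's
  inequality with the exponents \<open>1 + \<xi>\<close> and \<open>(1 + \<xi>) / \<xi>\<close> bounds the corresponding term.
\<close>

section \<open>Expectations over probability mass functions\<close>

text \<open>The transition functions \<open>P\<close> and \<open>PQ \<epsilon>\<close> are tied
  together only by their rates, so every comparison of them passes through the balance equations.
  Identifying the first marginal of \<open>pq \<epsilon>\<close> with \<open>p\<close> therefore
  needs both directions between stationarity and balance, as well as uniqueness of the stationary
  distribution. The test function is unbounded, since \<open>V\<close> has only a moment of order
  \<open>1 + \<xi>\<close>; the dominated convergence that works for single states does not cover
  it. Balancing the two gives \<open>\<epsilon> powr (\<xi> / (1 + \<xi>))\<close>, and the
  prefactor \<open>exp b - 1\<close> contributes one more power of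
  \<open>\<epsilon>\<close>.\<close>

lemma integral_measure_pmf_count_space:
  fixes g :: "'a \<Rightarrow> real"
  shows "measure_pmf.expectation p g = (\<integral>x. pmf p x * g x \<partial>count_space UNIV)"
  by (subst measure_pmf_eq_density, subst integral_density) auto

lemma integrable_measure_pmf_count_space:
  fixes g :: "'a \<Rightarrow> real"
  shows "integrable (measure_pmf p) g \<longleftrightarrow> integrable (count_space UNIV) (\<lambda>x. pmf p x * g x)"
  by (subst measure_pmf_eq_density, subst integrable_density) auto

text \<open>A convergent unordered sum of reals converges absolutely, so \<open>has_sum\<close>
  delivers integrability along with the value.\<close>

lemma has_sum_integral_pmf:
  fixes g :: "'a \<Rightarrow> real"
  assumes "((\<lambda>y. pmf p y * g y) has_sum S) UNIV"
  shows "integrable (measure_pmf p) g" and "measure_pmf.expectation p g = S"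
proof -
  have "(\<lambda>y. pmf p y * g y) summable_on UNIV"
    using assms by (rule has_sum_imp_summable)
  then have *: "Infinite_Set_Sum.abs_summable_on (\<lambda>y. pmf p y * g y) UNIV"
    by (rule summable_on_iff_abs_summable_on_real[THEN iffD1, THEN abs_summable_equivalent[THEN iffD1]])
  then show "integrable (measure_pmf p) g"
    unfolding integrable_measure_pmf_count_space Infinite_Set_Sum.abs_summable_on_def .
  show "measure_pmf.expectation p g = S"
    unfolding integral_measure_pmf_count_space infsetsum_def[symmetric] infsetsum_infsum[OF *]
    using assms by (rule infsumI)
qed

lemma integrable_pmf_bounded:
  fixes g :: "'a \<Rightarrow> real"
  assumes "\<And>x. \<bar>g x\<bar> \<le> B"
  shows "integrable (measure_pmf p) g"
  by (rule measure_pmf.integrable_const_bound[where B=B]) (use assms in auto)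

text \<open>Keeps only the path through the one intermediate state \<open>x\<close>. It yields lower
  bounds on return probabilities and carries positivity along the chain.\<close>

lemma pmf_bind_ge: "pmf p x * pmf (K x) y \<le> pmf (bind_pmf p K) y"
proof -
  have "pmf p x * pmf (K x) y = measure_pmf.expectation p (\<lambda>z. indicat_real {x} z * pmf (K x) y)"
    by (simp add: measure_pmf_single)
  also have "\<dots> \<le> measure_pmf.expectation p (\<lambda>z. pmf (K z) y)"
    by (intro integral_mono integrable_pmf_bounded[where B=1])
       (auto simp: pmf_le_1 indicator_def)
  finally show ?thesis by (simp add: pmf_bind)
qed

text \<open>The difference is nonnegative with total mass \<open>1 - 1 = 0\<close>. Later equalities
  of distributions thus need only a one-sided estimate.\<close>

lemma pmf_le_imp_eq:
  assumes le: "\<And>x. pmf p x \<le> pmf q x"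
  shows "p = q"
proof (rule pmf_eqI)
  fix x
  have "integrable (count_space UNIV) (\<lambda>x. pmf q x - pmf p x)"
    by (intro Bochner_Integration.integrable_diff integrable_pmf)
  moreover have "(\<integral>x. pmf q x - pmf p x \<partial>count_space UNIV) = 0"
    by (subst Bochner_Integration.integral_diff) (auto intro: integrable_pmf simp: integral_pmf)
  ultimately have "AE x in count_space UNIV. pmf q x - pmf p x = 0"
    by (subst integral_nonneg_eq_0_iff_AE[symmetric]) (auto simp: le)
  then show "pmf p x = pmf q x" by (auto simp: AE_count_space)
qed

lemma integral_bind_pmf_nonneg:
  fixes h :: "'b \<Rightarrow> real"
  assumes h: "\<And>y. 0 \<le> h y" and int: "integrable (measure_pmf (bind_pmf p K)) h"
    and intK: "\<And>x. integrable (measure_pmf (K x)) h"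
  shows "integrable (measure_pmf p) (\<lambda>x. measure_pmf.expectation (K x) h)"
    and "measure_pmf.expectation (bind_pmf p K) h
         = measure_pmf.expectation p (\<lambda>x. measure_pmf.expectation (K x) h)"
proof -
  have eq: "(\<integral>\<^sup>+x. ennreal (measure_pmf.expectation (K x) h) \<partial>measure_pmf p)
        = ennreal (measure_pmf.expectation (bind_pmf p K) h)"
  proof -
    have "ennreal (measure_pmf.expectation (bind_pmf p K) h) = (\<integral>\<^sup>+y. h y \<partial>bind_pmf p K)"
      by (rule nn_integral_eq_integral[symmetric]) (use h int in auto)
    also have "\<dots> = (\<integral>\<^sup>+x. \<integral>\<^sup>+y. h y \<partial>K x \<partial>p)"
      by (rule nn_integral_bind_pmf)
    also have "\<dots> = (\<integral>\<^sup>+x. ennreal (measure_pmf.expectation (K x) h) \<partial>measure_pmf p)"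
      by (intro nn_integral_cong nn_integral_eq_integral) (use h intK in auto)
    finally show ?thesis by simp
  qed
  show i: "integrable (measure_pmf p) (\<lambda>x. measure_pmf.expectation (K x) h)"
    by (rule integrableI_nonneg) (auto simp: eq h)
  show "measure_pmf.expectation (bind_pmf p K) h
         = measure_pmf.expectation p (\<lambda>x. measure_pmf.expectation (K x) h)"
    using eq nn_integral_eq_integral[OF i] by (simp add: h)
qed

text \<open>Fubini for a kernel, by applying Tonelli to the positive and negative parts of
  \<open>g\<close>.\<close>

lemma integral_bind_pmf_integrable:
  fixes g :: "'b \<Rightarrow> real"
  assumes int: "integrable (measure_pmf (bind_pmf p K)) g"
    and intK: "\<And>x. integrable (measure_pmf (K x)) g"
  shows "integrable (measure_pmf p) (\<lambda>x. measure_pmf.expectation (K x) g)"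
    and "measure_pmf.expectation (bind_pmf p K) g
         = measure_pmf.expectation p (\<lambda>x. measure_pmf.expectation (K x) g)"
proof -
  let ?u = "\<lambda>y. max 0 (g y)" and ?v = "\<lambda>y. max 0 (- g y)"
  have g: "g = (\<lambda>y. ?u y - ?v y)" by auto
  have sub: "measure_pmf.expectation P g = measure_pmf.expectation P ?u - measure_pmf.expectation P ?v"
    if "integrable (measure_pmf P) g" for P
    by (subst (1) g, subst Bochner_Integration.integral_diff) (use that in auto)
  note u = integral_bind_pmf_nonneg[where h="?u" and p=p and K=K]
  note v = integral_bind_pmf_nonneg[where h="?v" and p=p and K=K]
  have iu: "integrable (measure_pmf p) (\<lambda>x. measure_pmf.expectation (K x) ?u)"
    by (rule u) (use assms in auto)
  have iv: "integrable (measure_pmf p) (\<lambda>x. measure_pmf.expectation (K x) ?v)"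
    by (rule v) (use assms in auto)
  have *: "(\<lambda>x. measure_pmf.expectation (K x) g)
      = (\<lambda>x. measure_pmf.expectation (K x) ?u - measure_pmf.expectation (K x) ?v)"
    using sub[OF intK] by auto
  show "integrable (measure_pmf p) (\<lambda>x. measure_pmf.expectation (K x) g)"
    unfolding * using iu iv by simp
  have "measure_pmf.expectation (bind_pmf p K) ?u = measure_pmf.expectation p (\<lambda>x. measure_pmf.expectation (K x) ?u)"
    by (rule u) (use assms in auto)
  moreover have "measure_pmf.expectation (bind_pmf p K) ?v = measure_pmf.expectation p (\<lambda>x. measure_pmf.expectation (K x) ?v)"
    by (rule v) (use assms in auto)
  ultimately show "measure_pmf.expectation (bind_pmf p K) g
         = measure_pmf.expectation p (\<lambda>x. measure_pmf.expectation (K x) g)"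
    unfolding * using sub[OF int] iu iv by simp
qed

section \<open>Stationarity and global balance\<close>

text \<open>
  The normalized positive part of the difference of two stationary distributions is stationary,
  hence by irreducibility zero or positive everywhere.
\<close>

lemma irreducible_stationary_unique:
  assumes irr: "irreducible_chain P" and p: "stationary P p" and p': "stationary P p'"
  shows "p = p'"
proof (rule ccontr)
  assume "p \<noteq> p'"
  then obtain k where k: "pmf p' k < pmf p k"
    using pmf_le_imp_eq[of p p'] by (meson not_le)
  define e where "e x = max 0 (pmf p x - pmf p' x)" for x
  define M where "M = (\<integral>x. e x \<partial>count_space UNIV)"
  have e0: "0 \<le> e x" for x by (simp add: e_def)
  have ie: "integrable (count_space UNIV) e"
    unfolding e_def by (intro integrable_max integrable_zero Bochner_Integration.integrable_diff integrable_pmf)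
  have "M \<noteq> 0"
  proof
    assume "M = 0"
    then have "AE x in count_space UNIV. e x = 0"
      unfolding M_def using integral_nonneg_eq_0_iff_AE[OF ie] e0 by auto
    then have "e k = 0" by (simp add: AE_count_space)
    then show False using k by (simp add: e_def)
  qed
  moreover have "0 \<le> M" unfolding M_def by (simp add: e0)
  ultimately have M: "0 < M" by simp
  have one: "(\<integral>\<^sup>+x. ennreal (e x / M) \<partial>count_space UNIV) = 1"
    by (subst nn_integral_eq_integral) (use ie M e0 in \<open>auto simp: M_def\<close>)
  define E where "E = embed_pmf (\<lambda>x. e x / M)"
  have E: "pmf E x = e x / M" for x
    unfolding E_def by (rule pmf_embed_pmf) (use M e0 one in auto)
  have inv: "bind_pmf E (P t) = E" if t: "0 \<le> t" for t
  proof (rule pmf_le_imp_eq[symmetric])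
    fix j
    have "pmf p j - pmf p' j = pmf (bind_pmf p (P t)) j - pmf (bind_pmf p' (P t)) j"
      using p p' t by (simp add: stationary_def)
    also have "\<dots> = (\<integral>i. pmf p i * pmf (P t i) j - pmf p' i * pmf (P t i) j \<partial>count_space UNIV)"
      unfolding pmf_bind integral_measure_pmf_count_space
      by (rule Bochner_Integration.integral_diff[symmetric])
         (intro integrable_measure_pmf_count_space[THEN iffD1] integrable_pmf_bounded[where B=1]; simp add: pmf_le_1)+
    \<comment> \<open>Where \<open>p\<close> lies below \<open>p'\<close> the integrand is
      nonpositive and \<open>e\<close> is 0, so passing to \<open>e = M * pmf E\<close> can only
      increase the integral.\<close>
    also have "\<dots> \<le> (\<integral>i. M * (pmf E i * pmf (P t i) j) \<partial>count_space UNIV)"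
      using M
      by (intro integral_mono Bochner_Integration.integrable_diff integrable_mult_right
             integrable_measure_pmf_count_space[THEN iffD1] integrable_pmf_bounded[where B=1])
         (auto simp: pmf_le_1 E e_def left_diff_distrib[symmetric] intro!: mult_right_mono)
    also have "\<dots> = M * pmf (bind_pmf E (P t)) j"
      by (simp add: pmf_bind integral_measure_pmf_count_space)
    finally have "pmf p j - pmf p' j \<le> M * pmf (bind_pmf E (P t)) j" .
    then have "e j \<le> M * pmf (bind_pmf E (P t)) j"
      using M by (simp add: e_def)
    then show "pmf E j \<le> pmf (bind_pmf E (P t)) j"
      using M by (simp add: E field_simps)
  qed
  \<comment> \<open>\<open>E\<close> charges \<open>k\<close>, hence by invariance and
    irreducibility every state; so \<open>p'\<close> is strictly below \<open>p\<close> everywhere,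
    which equal total masses forbid.\<close>
  have "pmf p' j \<le> pmf p j" for j
  proof -
    obtain t where t: "0 \<le> t" "0 < pmf (P t k) j"
      using irr by (auto simp: irreducible_chain_def)
    have "0 < pmf E k * pmf (P t k) j"
      using t k M by (simp add: E e_def)
    also have "\<dots> \<le> pmf E j"
      using pmf_bind_ge[of E k "P t" j] inv[OF t(1)] by simp
    finally show ?thesis using M by (simp add: E e_def zero_less_divide_iff max_def split: if_splits)
  qed
  then have "p' = p" by (rule pmf_le_imp_eq)
  then show False using \<open>p \<noteq> p'\<close> by simp
qed

lemma bounded_rates_nonneg: "bounded_rates r \<Longrightarrow> i \<noteq> j \<Longrightarrow> 0 \<le> r i j"
  by (auto simp: bounded_rates_def)

lemma bounded_rates_le_exit_rate:
  assumes "bounded_rates r" and "i \<noteq> j"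
  shows "r i j \<le> exit_rate r i"
proof -
  have "sum (r i) {j} \<le> exit_rate r i"
    unfolding exit_rate_def
    by (rule finite_sum_le_infsum) (use assms in \<open>auto simp: bounded_rates_def\<close>)
  then show ?thesis by simp
qed

lemma exit_rate_nonneg: "bounded_rates r \<Longrightarrow> 0 \<le> exit_rate r i"
  unfolding exit_rate_def by (rule infsum_nonneg) (auto simp: bounded_rates_def)

lemma exit_rate_bound:
  assumes "bounded_rates r"
  obtains C where "0 < C" and "\<And>i. exit_rate r i \<le> C"
proof -
  obtain B where "\<And>i. exit_rate r i \<le> B"
    using assms by (auto simp: bounded_rates_def bdd_above_def)
  \<comment> \<open>The maximum with 1 makes the bound strictly positive, so that uniformization can
    divide by it.\<close>
  then have "exit_rate r i \<le> max B 1" for i by (meson le_max_iff_disj)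
  then show ?thesis using that[of "max B 1"] by simp
qed

lemma abs_generator_le:
  assumes "bounded_rates r"
  shows "\<bar>generator r i j\<bar> \<le> exit_rate r i"
  using bounded_rates_le_exit_rate[OF assms] exit_rate_nonneg[OF assms] bounded_rates_nonneg[OF assms]
  by (auto simp: generator_def)

lemma norm_divide_le:
  fixes x h C :: real
  assumes "0 < h" and "\<bar>x\<bar> \<le> C * h"
  shows "norm (x / h) \<le> C"
  using assms by (simp add: pos_divide_le_eq)

text \<open>These step lengths serve two ends: derivatives at 0 are taken along them, and
  \<open>Suc n\<close> steps of length \<open>t / Suc n\<close> fill the interval from 0 to
  \<open>t\<close> exactly.\<close>

lemma tendsto_div_Suc_at_right:
  assumes "0 < (t::real)"
  shows "filterlim (\<lambda>n. t / real (Suc n)) (at_right 0) sequentially"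
proof -
  have "(\<lambda>n. t / real (Suc n)) \<longlonglongrightarrow> 0"
    using LIMSEQ_Suc[OF lim_const_over_n[of t]] by simp
  then show ?thesis
    using assms by (auto simp: filterlim_at)
qed

text \<open>
  The return probability is supermultiplicative in time, so Bernoulli's inequality turns its
  derivative at 0 into a bound for all times.
\<close>

lemma ctmc_leave_prob_le:
  assumes P: "ctmc r P" and t: "0 \<le> t"
  shows "1 - pmf (P t i) i \<le> exit_rate r i * t"
proof (cases "t = 0")
  case True
  then show ?thesis using P by (simp add: ctmc_def)
next
  case False
  with t have t: "0 < t" by simp
  have pow: "pmf (P h i) i ^ n \<le> pmf (P (real n * h) i) i" if "0 \<le> h" for h n
  proof (induction n)
    case 0
    then show ?case using P by (simp add: ctmc_def)
  next
    case (Suc n)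
    have "pmf (P h i) i ^ Suc n \<le> pmf (P h i) i * pmf (P (real n * h) i) i"
      using Suc by (simp add: mult_left_mono)
    also have "\<dots> \<le> pmf (bind_pmf (P h i) (P (real n * h))) i"
      by (rule pmf_bind_ge)
    also have "bind_pmf (P h i) (P (real n * h)) = P (h + real n * h) i"
      using P that by (simp add: ctmc_def)
    finally show ?case by (simp add: algebra_simps)
  qed
  let ?h = "\<lambda>n. t / real (Suc n)"
  have le: "1 - pmf (P t i) i \<le> - t * ((pmf (P (?h n) i) i - pmf (P 0 i) i) / ?h n)" for n
  proof -
    have "1 + real (Suc n) * (pmf (P (?h n) i) i - 1) \<le> (1 + (pmf (P (?h n) i) i - 1)) ^ Suc n"
      by (rule Bernoulli_inequality) simp
    also have "\<dots> \<le> pmf (P t i) i"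
      using pow[of "?h n" "Suc n"] t by simp
    finally have "1 - pmf (P t i) i \<le> - (real (Suc n) * (pmf (P (?h n) i) i - 1))"
      by simp
    also have "\<dots> = - t * ((pmf (P (?h n) i) i - 1) / ?h n)"
      using t by (simp add: field_simps)
    finally show ?thesis using P by (simp add: ctmc_def)
  qed
  have "((\<lambda>t. (pmf (P t i) i - pmf (P 0 i) i) / t) \<longlongrightarrow> generator r i i) (at_right 0)"
    using P unfolding ctmc_def by blast
  then have "(\<lambda>n. (pmf (P (?h n) i) i - pmf (P 0 i) i) / ?h n) \<longlonglongrightarrow> generator r i i"
    by (rule filterlim_compose[OF _ tendsto_div_Suc_at_right[OF t]])
  then have "(\<lambda>n. - t * ((pmf (P (?h n) i) i - pmf (P 0 i) i) / ?h n)) \<longlonglongrightarrow> - t * generator r i i"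
    by (rule tendsto_mult_left)
  then have "1 - pmf (P t i) i \<le> - t * generator r i i"
    by (rule LIMSEQ_le_const) (use le in auto)
  then show ?thesis by (simp add: generator_def mult.commute)
qed

text \<open>Off the diagonal, being in \<open>j\<close> is part of having left \<open>i\<close>. As
  exit rates are bounded, this dominates the difference quotients uniformly in the starting
  state.\<close>

lemma ctmc_increment_le:
  assumes P: "ctmc r P" and t: "0 \<le> t"
  shows "\<bar>pmf (P t i) j - pmf (P 0 i) j\<bar> \<le> exit_rate r i * t"
proof -
  have 0: "pmf (P 0 i) j = (if i = j then 1 else 0)"
    using P by (simp add: ctmc_def indicator_def)
  have *: "1 - pmf (P t i) i \<le> exit_rate r i * t" by (rule ctmc_leave_prob_le[OF assms])
  show ?thesis
  proof (cases "i = j")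
    case True
    then show ?thesis using * 0 by (simp add: pmf_le_1)
  next
    case False
    have "pmf (P t i) i + pmf (P t i) j = measure_pmf.prob (P t i) {i, j}"
      using False by (simp add: measure_measure_pmf_finite)
    also have "\<dots> \<le> 1" by simp
    finally show ?thesis using * 0 False by simp
  qed
qed

text \<open>The difference quotients are bounded by a constant, so the derivative at 0 passes under
  the mean over \<open>p\<close>. The limit is the net flow of probability into \<open>j\<close>;
  \<open>p\<close> is arbitrary, so both directions between stationarity and balance can use
  it.\<close>

lemma ctmc_flow_tendsto:
  assumes r: "bounded_rates r" and P: "ctmc r P" and t: "0 < t"
  shows "(\<lambda>n. (pmf (bind_pmf p (P (t / real (Suc n)))) j - pmf p j) / (t / real (Suc n)))
           \<longlonglongrightarrow> measure_pmf.expectation p (\<lambda>i. generator r i j)"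
proof -
  let ?h = "\<lambda>n. t / real (Suc n)"
  obtain C where C: "0 < C" "\<And>i. exit_rate r i \<le> C" by (rule exit_rate_bound[OF r]) blast
  have h: "0 < ?h n" for n using t by simp
  have "(\<lambda>n. measure_pmf.expectation p (\<lambda>i. (pmf (P (?h n) i) j - pmf (P 0 i) j) / ?h n))
          \<longlonglongrightarrow> measure_pmf.expectation p (\<lambda>i. generator r i j)"
  proof (rule integral_dominated_convergence[where w="\<lambda>_. C"])
    show "AE i in measure_pmf p. (\<lambda>n. (pmf (P (?h n) i) j - pmf (P 0 i) j) / ?h n) \<longlonglongrightarrow> generator r i j"
      using P filterlim_compose[OF _ tendsto_div_Suc_at_right[OF t]] by (fastforce simp: ctmc_def)
    show "AE i in measure_pmf p. norm ((pmf (P (?h n) i) j - pmf (P 0 i) j) / ?h n) \<le> C" for n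
    proof (rule AE_I2)
      fix i
      have "\<bar>pmf (P (?h n) i) j - pmf (P 0 i) j\<bar> \<le> exit_rate r i * ?h n"
        using ctmc_increment_le[OF P] h[of n] less_imp_le by blast
      also have "\<dots> \<le> C * ?h n" using C h[of n] by (intro mult_right_mono) auto
      finally show "norm ((pmf (P (?h n) i) j - pmf (P 0 i) j) / ?h n) \<le> C"
        by (rule norm_divide_le[OF h])
    qed
  qed auto
  moreover have "measure_pmf.expectation p (\<lambda>i. (pmf (P (?h n) i) j - pmf (P 0 i) j) / ?h n)
      = (pmf (bind_pmf p (P (?h n))) j - pmf p j) / ?h n" for n
  proof -
    have "pmf (bind_pmf p (P (?h n))) j - pmf (bind_pmf p (P 0)) j
      = measure_pmf.expectation p (\<lambda>i. pmf (P (?h n) i) j - pmf (P 0 i) j)"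
      unfolding pmf_bind
      by (rule Bochner_Integration.integral_diff[symmetric])
         (intro integrable_pmf_bounded[where B=1]; simp add: pmf_le_1)+
    moreover have "bind_pmf p (P 0) = p"
    proof -
      have "P 0 = return_pmf" using P by (auto simp: ctmc_def)
      then show ?thesis by (simp add: bind_return_pmf')
    qed
    ultimately show ?thesis by simp
  qed
  ultimately show ?thesis by (simp only:)
qed

lemma stationary_imp_balance:
  assumes "bounded_rates r" and "ctmc r P" and "stationary P p"
  shows "measure_pmf.expectation p (\<lambda>i. generator r i j) = 0"
proof -
  have "(\<lambda>n. (pmf (bind_pmf p (P (1 / real (Suc n)))) j - pmf p j) / (1 / real (Suc n)))
          = (\<lambda>n. 0)"
    using assms(3) by (simp add: stationary_def)
  then have "(\<lambda>n. 0) \<longlonglongrightarrow> measure_pmf.expectation p (\<lambda>i. generator r i j)"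
    using ctmc_flow_tendsto[OF assms(1,2), of 1 p j] by (simp only: zero_less_one)
  then show ?thesis
    by (rule LIMSEQ_unique[OF _ tendsto_const])
qed

text \<open>
  The total mass that \<open>p\<close> loses over a time step \<open>h\<close> is \<open>o(h)\<close> by dominated convergence, since
  the loss at \<open>k\<close> is at most \<open>C * h * pmf p k\<close>; summing over \<open>t / h\<close> steps, nothing is lost by
  time \<open>t\<close>.
\<close>

lemma balance_imp_stationary:
  assumes r: "bounded_rates r" and P: "ctmc r P"
    and bal: "\<And>j. measure_pmf.expectation p (\<lambda>i. generator r i j) = 0"
  shows "stationary P p"
  unfolding stationary_def
proof (intro allI impI)
  fix t :: real assume "0 \<le> t"
  have P0: "P 0 = return_pmf" using P by (auto simp: ctmc_def)
  show "bind_pmf p (P t) = p"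
  proof (cases "t = 0")
    case True
    then show ?thesis by (simp add: P0 bind_return_pmf')
  next
    case False
    with \<open>0 \<le> t\<close> have t: "0 < t" by simp
    obtain C where C: "0 < C" "\<And>i. exit_rate r i \<le> C" by (rule exit_rate_bound[OF r]) blast
    define loss where "loss h k = max 0 (pmf p k - pmf (bind_pmf p (P h)) k)" for h k
    define D where "D h = (\<integral>k. loss h k \<partial>count_space UNIV)" for h
    have iloss: "integrable (count_space UNIV) (loss h)" for h
      unfolding loss_def
      by (intro integrable_max integrable_zero Bochner_Integration.integrable_diff integrable_pmf)
    \<comment> \<open>A further kernel \<open>P u\<close> cannot enlarge a deficit: the total mass
      lost over time \<open>h\<close> bounds the deficit at any \<open>j\<close>, whatever
      \<open>u\<close> is.\<close>
    have step: "pmf (bind_pmf p (P u)) j - pmf (bind_pmf p (P (h + u))) j \<le> D h"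
      if "0 \<le> h" "0 \<le> u" for h u j
    proof -
      have "P (h + u) = (\<lambda>i. bind_pmf (P h i) (P u))"
        using P that by (auto simp: ctmc_def)
      then have "bind_pmf p (P (h + u)) = bind_pmf (bind_pmf p (P h)) (P u)"
        by (simp add: bind_assoc_pmf)
      then have "pmf (bind_pmf p (P u)) j - pmf (bind_pmf p (P (h + u))) j
        = (\<integral>i. pmf p i * pmf (P u i) j \<partial>count_space UNIV)
          - (\<integral>i. pmf (bind_pmf p (P h)) i * pmf (P u i) j \<partial>count_space UNIV)"
        by (simp only: pmf_bind[of _ "P u"] integral_measure_pmf_count_space)
      also have "\<dots> = (\<integral>i. pmf p i * pmf (P u i) j - pmf (bind_pmf p (P h)) i * pmf (P u i) j
                       \<partial>count_space UNIV)"
        by (rule Bochner_Integration.integral_diff[symmetric])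
           (intro integrable_measure_pmf_count_space[THEN iffD1] integrable_pmf_bounded[where B=1]; simp add: pmf_le_1)+
      also have "\<dots> \<le> D h"
        unfolding D_def
      proof (intro integral_mono iloss Bochner_Integration.integrable_diff
             integrable_measure_pmf_count_space[THEN iffD1] integrable_pmf_bounded[where B=1])
        fix k
        have "pmf p k * pmf (P u k) j - pmf (bind_pmf p (P h)) k * pmf (P u k) j
            \<le> loss h k * pmf (P u k) j"
          unfolding left_diff_distrib[symmetric] by (intro mult_right_mono) (auto simp: loss_def)
        also have "\<dots> \<le> loss h k * 1"
          by (intro mult_left_mono) (auto simp: loss_def pmf_le_1)
        finally show "pmf p k * pmf (P u k) j - pmf (bind_pmf p (P h)) k * pmf (P u k) j \<le> loss h k"
          by simp
      qed (simp_all add: pmf_le_1)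
      finally show ?thesis .
    qed
    have steps: "pmf p j - pmf (bind_pmf p (P (real n * h))) j \<le> real n * D h" if "0 \<le> h" for h n j
    proof (induction n)
      case 0
      then show ?case by (simp add: P0 bind_return_pmf')
    next
      case (Suc n)
      then show ?case
        using step[of h "real n * h" j] that by (simp add: algebra_simps)
    qed
    let ?h = "\<lambda>n. t / real (Suc n)"
    have h: "0 < ?h n" for n using t by simp
    have "(\<lambda>n. \<integral>k. loss (?h n) k / ?h n \<partial>count_space UNIV) \<longlonglongrightarrow> (\<integral>k. (0::real) \<partial>count_space (UNIV :: 'a set))"
    proof (rule integral_dominated_convergence[where w="\<lambda>k. C * pmf p k"])
      show "AE k in count_space UNIV. (\<lambda>n. loss (?h n) k / ?h n) \<longlonglongrightarrow> 0"
      proof (rule AE_I2)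
        fix k
        have "(\<lambda>n. max 0 (- ((pmf (bind_pmf p (P (?h n))) k - pmf p k) / ?h n))) \<longlonglongrightarrow> max 0 (- 0)"
          using ctmc_flow_tendsto[OF r P t, of p k] unfolding bal
          by (intro tendsto_max tendsto_minus tendsto_const)
        moreover have "max 0 (- ((pmf (bind_pmf p (P (?h n))) k - pmf p k) / ?h n)) = loss (?h n) k / ?h n" for n
          unfolding loss_def minus_divide_left minus_diff_eq
          using h[of n] by (simp only: max_divide_distrib_right div_0 if_True less_imp_le)
        ultimately show "(\<lambda>n. loss (?h n) k / ?h n) \<longlonglongrightarrow> 0" by simp
      qed
      show "AE k in count_space UNIV. norm (loss (?h n) k / ?h n) \<le> C * pmf p k" for n
      proof (rule AE_I2)
        fix k
        have "pmf p k - pmf (bind_pmf p (P (?h n))) k \<le> pmf p k - pmf p k * pmf (P (?h n) k) k"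
          using pmf_bind_ge[of p k "P (?h n)" k] by simp
        also have "\<dots> = pmf p k * (1 - pmf (P (?h n) k) k)" by (simp add: algebra_simps)
        also have "\<dots> \<le> pmf p k * (C * ?h n)"
        proof (rule mult_left_mono)
          have "1 - pmf (P (?h n) k) k \<le> exit_rate r k * ?h n"
            using ctmc_leave_prob_le[OF P] h[of n] less_imp_le by blast
          also have "\<dots> \<le> C * ?h n" using C h[of n] by (intro mult_right_mono) auto
          finally show "1 - pmf (P (?h n) k) k \<le> C * ?h n" .
        qed simp
        finally have "loss (?h n) k \<le> pmf p k * (C * ?h n)"
          using C h[of n] unfolding loss_def by (intro max.boundedI mult_nonneg_nonneg) auto
        moreover have "0 \<le> loss (?h n) k" by (simp add: loss_def)
        ultimately show "norm (loss (?h n) k / ?h n) \<le> C * pmf p k"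
          by (intro norm_divide_le[OF h]) (simp add: mult_ac)
      qed
    qed (auto intro: integrable_pmf)
    then have "(\<lambda>n. t * (D (?h n) / ?h n)) \<longlonglongrightarrow> t * 0"
      by (intro tendsto_mult_left) (simp add: D_def del: of_nat_Suc)
    moreover have "t * (D (?h n) / ?h n) = real (Suc n) * D (?h n)" for n
      using t by (simp add: field_simps)
    ultimately have lim: "(\<lambda>n. real (Suc n) * D (?h n)) \<longlonglongrightarrow> 0" by simp
    have "pmf p j - pmf (bind_pmf p (P t)) j \<le> 0" for j
    proof (rule LIMSEQ_le_const[OF lim])
      have "pmf p j - pmf (bind_pmf p (P t)) j \<le> real (Suc n) * D (?h n)" for n
        using steps[of "?h n" j "Suc n"] h[of n] by simp
      then show "\<exists>N. \<forall>n\<ge>N. pmf p j - pmf (bind_pmf p (P t)) j \<le> real (Suc n) * D (?h n)"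
        by blast
    qed
    then show ?thesis by (intro pmf_le_imp_eq[symmetric]) simp
  qed
qed

section \<open>Drift and uniformization\<close>

text \<open>The generator applied to the function \<open>g\<close>, with the diagonal term split
  off. It has this meaning only where the sum converges, hence the summability hypotheses
  below.\<close>

definition drift :: "('s \<Rightarrow> 's \<Rightarrow> real) \<Rightarrow> ('s \<Rightarrow> real) \<Rightarrow> 's \<Rightarrow> real" where
  "drift r g i = (\<Sum>\<^sub>\<infinity>j\<in>-{i}. r i j * g j) - exit_rate r i * g i"

lemma has_sum_generator:
  assumes "(\<lambda>j. r i j * g j) summable_on -{i}"
  shows "((\<lambda>j. generator r i j * g j) has_sum drift r g i) UNIV"
proof -
  have "((\<lambda>j. generator r i j * g j) has_sum (\<Sum>\<^sub>\<infinity>j\<in>-{i}. r i j * g j)) (-{i})"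
    using has_sum_infsum[OF assms]
    by (rule has_sum_cong[THEN iffD1, rotated]) (auto simp: generator_def)
  then have "((\<lambda>j. generator r i j * g j) has_sum
      (generator r i i * g i + (\<Sum>\<^sub>\<infinity>j\<in>-{i}. r i j * g j))) (insert i (-{i}))"
    by (intro has_sum_insert) auto
  moreover have "insert i (-{i}) = UNIV" by auto
  ultimately show ?thesis by (simp add: drift_def generator_def)
qed

text \<open>
  Uniformization turns global balance into invariance under a single kernel, so that the mean drift
  identity becomes an instance of Fubini's theorem for \<open>bind_pmf\<close>.
\<close>

definition uniformized :: "('s \<Rightarrow> 's \<Rightarrow> real) \<Rightarrow> real \<Rightarrow> 's \<Rightarrow> 's pmf" where
  "uniformized r C i = embed_pmf (\<lambda>j. of_bool (i = j) + generator r i j / C)"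

context
  fixes r :: "'s \<Rightarrow> 's \<Rightarrow> real" and C :: real
  assumes r: "bounded_rates r" and C: "0 < C" "\<And>i. exit_rate r i \<le> C"
begin

lemma has_sum_uniformized:
  assumes "(\<lambda>j. r i j * g j) summable_on -{i}"
  shows "((\<lambda>j. (of_bool (i = j) + generator r i j / C) * g j) has_sum (g i + drift r g i / C)) UNIV"
proof -
  have "((\<lambda>j. of_bool (i = j) * g j) has_sum g i) UNIV"
    by (rule has_sum_finite_neutralI[of "{i}"]) auto
  moreover have "((\<lambda>j. generator r i j * g j * (1 / C)) has_sum drift r g i * (1 / C)) UNIV"
    by (intro has_sum_cmult_left has_sum_generator assms)
  ultimately have "((\<lambda>j. of_bool (i = j) * g j + generator r i j * g j * (1 / C)) has_sum
      (g i + drift r g i * (1 / C))) UNIV"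
    by (rule has_sum_add)
  then show ?thesis by (simp add: distrib_right)
qed

text \<open>The kernel is \<open>I + Q / C\<close> with \<open>Q\<close> the generator. Its diagonal
  is nonnegative because \<open>C\<close> bounds the exit rates, and its rows sum to 1 because
  constants have zero drift.\<close>

lemma pmf_uniformized: "pmf (uniformized r C i) j = of_bool (i = j) + generator r i j / C"
  unfolding uniformized_def
proof (rule pmf_embed_pmf)
  let ?w = "\<lambda>j. of_bool (i = j) + generator r i j / C"
  show nonneg: "0 \<le> ?w j" for j
    using C bounded_rates_nonneg[OF r] by (auto simp: generator_def)
  have "drift r (\<lambda>_. 1) i = 0" by (simp add: drift_def exit_rate_def)
  moreover have "r i summable_on -{i}" using r by (simp add: bounded_rates_def)
  ultimately have hs: "(?w has_sum 1) UNIV"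
    using has_sum_uniformized[of i "\<lambda>_. 1"] by simp
  have "Infinite_Set_Sum.abs_summable_on ?w UNIV"
    using has_sum_imp_summable[OF hs]
    by (rule summable_on_iff_abs_summable_on_real[THEN iffD1, THEN abs_summable_equivalent[THEN iffD1]])
  then have "integrable (count_space UNIV) ?w" and "(\<integral>j. ?w j \<partial>count_space UNIV) = 1"
    using infsetsum_infsum[of ?w UNIV] infsumI[OF hs]
    by (simp_all add: Infinite_Set_Sum.abs_summable_on_def infsetsum_def)
  then show "(\<integral>\<^sup>+j. ennreal (?w j) \<partial>count_space UNIV) = 1"
    by (subst nn_integral_eq_integral) (auto simp: nonneg)
qed

lemma expectation_uniformized:
  assumes "(\<lambda>j. r i j * g j) summable_on -{i}"
  shows "integrable (measure_pmf (uniformized r C i)) g"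
    and "measure_pmf.expectation (uniformized r C i) g = g i + drift r g i / C"
  using has_sum_integral_pmf[of "uniformized r C i" g "g i + drift r g i / C"]
    has_sum_uniformized[OF assms]
  by (simp_all add: pmf_uniformized)

lemma bind_uniformized:
  assumes bal: "\<And>j. measure_pmf.expectation p (\<lambda>i. generator r i j) = 0"
  shows "bind_pmf p (uniformized r C) = p"
proof (rule pmf_eqI)
  fix j
  have "integrable (measure_pmf p) (\<lambda>i. generator r i j)"
    by (rule integrable_pmf_bounded[where B=C]) (use abs_generator_le[OF r] C order_trans in blast)
  moreover have "measure_pmf.expectation p (\<lambda>i. of_bool (i = j)) = pmf p j"
    by (subst integral_measure_pmf[of "{j}"]) (auto split: if_splits)
  moreover have "integrable (measure_pmf p) (\<lambda>i. of_bool (i = j) :: real)"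
    by (rule integrable_pmf_bounded[where B=1]) auto
  ultimately show "pmf (bind_pmf p (uniformized r C)) j = pmf p j"
    using bal by (simp add: pmf_bind pmf_uniformized)
qed

end

text \<open>Invariance under \<open>I + Q / C\<close> says that \<open>g\<close> and
  \<open>g + drift r g / C\<close> have the same mean. No limit in time occurs, so integrability of
  \<open>g\<close> replaces boundedness.\<close>

lemma expectation_drift_eq_0:
  fixes g :: "'s \<Rightarrow> real"
  assumes r: "bounded_rates r"
    and bal: "\<And>j. measure_pmf.expectation p (\<lambda>i. generator r i j) = 0"
    and g: "integrable (measure_pmf p) g"
    and sum: "\<And>i. (\<lambda>j. r i j * g j) summable_on -{i}"
  shows "integrable (measure_pmf p) (drift r g)" and "measure_pmf.expectation p (drift r g) = 0"
proof -
  obtain C where C: "0 < C" "\<And>i. exit_rate r i \<le> C" by (rule exit_rate_bound[OF r]) blast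
  note K = bind_uniformized[OF r C bal] expectation_uniformized[OF r C sum]
  have gK: "integrable (measure_pmf (bind_pmf p (uniformized r C))) g"
    using g K(1) by simp
  have i: "integrable (measure_pmf p) (\<lambda>x. g x + drift r g x / C)"
    and e: "measure_pmf.expectation p g = measure_pmf.expectation p (\<lambda>x. g x + drift r g x / C)"
    using integral_bind_pmf_integrable[OF gK K(2)] unfolding K(1) K(3) by auto
  have "integrable (measure_pmf p) (\<lambda>x. C * ((g x + drift r g x / C) - g x))"
    using i g by (intro integrable_mult_right Bochner_Integration.integrable_diff)
  then show *: "integrable (measure_pmf p) (drift r g)"
    using C(1) by simp
  show "measure_pmf.expectation p (drift r g) = 0"
    using e C(1) g * by simp
qed

section \<open>Drift of the queue\<close>

text \<open>A jump changes only one component, so the rates split into three families with disjoint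
  supports: at most one target each for arrival and service, and a copy of row \<open>i\<close> of
  \<open>\<alpha>\<close>.\<close>

lemma has_sum_queue_rates:
  fixes \<alpha> :: "'z \<Rightarrow> 'z \<Rightarrow> real" and g :: "'z \<times> nat \<Rightarrow> real"
  assumes "(\<lambda>i'. \<alpha> i i' * g (i', q)) summable_on -{i}"
  shows "((\<lambda>y. queue_rates \<alpha> l m (i, q) y * g y) has_sum
      (l i * g (i, q + 1) + (if q > 0 then m i * g (i, q - 1) else 0)
        + (\<Sum>\<^sub>\<infinity>i'\<in>-{i}. \<alpha> i i' * g (i', q)))) (-{(i, q)})"
proof -
  let ?up = "\<lambda>y. of_bool (y = (i, q + 1)) * (l i * g y)"
  let ?down = "\<lambda>y. of_bool (q > 0 \<and> y = (i, q - 1)) * (m i * g y)"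
  let ?mod = "\<lambda>y. of_bool (fst y \<noteq> i \<and> snd y = q) * (\<alpha> i (fst y) * g y)"
  have "(?up has_sum l i * g (i, q + 1)) (-{(i, q)})"
    by (rule has_sum_finite_neutralI[of "{(i, q + 1)}"]) auto
  moreover have "(?down has_sum (if q > 0 then m i * g (i, q - 1) else 0)) (-{(i, q)})"
    by (rule has_sum_finite_neutralI[of "if q > 0 then {(i, q - 1)} else {}"]) auto
  moreover have "(?mod has_sum (\<Sum>\<^sub>\<infinity>i'\<in>-{i}. \<alpha> i i' * g (i', q))) (-{(i, q)})"
  proof -
    \<comment> \<open>The modulating jumps live on the slice with queue length \<open>q\<close>; the
      sum is transported there and then extended by zeros.\<close>
    have "((\<lambda>y. \<alpha> i (fst y) * g y) has_sum (\<Sum>\<^sub>\<infinity>i'\<in>-{i}. \<alpha> i i' * g (i', q))) ((\<lambda>i'. (i', q)) ` (-{i}))"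
      using has_sum_infsum[OF assms] by (subst has_sum_reindex) (auto simp: inj_on_def o_def)
    then show ?thesis
      by (rule has_sum_cong_neutral[THEN iffD1, rotated -1]) auto
  qed
  ultimately have "((\<lambda>y. ?up y + ?down y + ?mod y) has_sum
      (l i * g (i, q + 1) + (if q > 0 then m i * g (i, q - 1) else 0)
        + (\<Sum>\<^sub>\<infinity>i'\<in>-{i}. \<alpha> i i' * g (i', q)))) (-{(i, q)})"
    by (intro has_sum_add)
  then show ?thesis
    by (rule has_sum_cong[THEN iffD1, rotated]) auto
qed

lemma exit_rate_queue_rates:
  assumes "bounded_rates \<alpha>"
  shows "exit_rate (queue_rates \<alpha> l m) (i, q) = l i + (if q > 0 then m i else 0) + exit_rate \<alpha> i"
    and "queue_rates \<alpha> l m (i, q) summable_on -{(i, q)}"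
proof -
  have "\<alpha> i summable_on -{i}" using assms by (simp add: bounded_rates_def)
  then have *: "(queue_rates \<alpha> l m (i, q) has_sum
      (l i + (if q > 0 then m i else 0) + exit_rate \<alpha> i)) (-{(i, q)})"
    using has_sum_queue_rates[of \<alpha> i "\<lambda>_. 1" q l m] by (simp only: exit_rate_def mult_1_right)
  show "exit_rate (queue_rates \<alpha> l m) (i, q) = l i + (if q > 0 then m i else 0) + exit_rate \<alpha> i"
    using * unfolding exit_rate_def[of "queue_rates \<alpha> l m"] by (rule infsumI)
  show "queue_rates \<alpha> l m (i, q) summable_on -{(i, q)}"
    using * by (rule has_sum_imp_summable)
qed

lemma bounded_rates_queue_rates:
  assumes \<alpha>: "bounded_rates \<alpha>" and l: "\<And>i. 0 \<le> l i" "\<And>i. l i \<le> L"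
    and m: "\<And>i. 0 \<le> m i" "\<And>i. m i \<le> M"
  shows "bounded_rates (queue_rates \<alpha> l m)"
  unfolding bounded_rates_def
proof (intro conjI allI impI)
  fix x y
  show "0 \<le> queue_rates \<alpha> l m x y"
    using l m bounded_rates_nonneg[OF \<alpha>] by (cases x; cases y) auto
  show "queue_rates \<alpha> l m x summable_on -{x}"
    by (cases x) (simp add: exit_rate_queue_rates[OF \<alpha>])
next
  obtain C where C: "\<And>i. exit_rate \<alpha> i \<le> C" by (rule exit_rate_bound[OF \<alpha>]) blast
  have "exit_rate (queue_rates \<alpha> l m) (i, q) \<le> L + M + C" for i q
    using l(2)[of i] m[of i] C[of i] by (auto simp: exit_rate_queue_rates[OF \<alpha>])
  then show "bdd_above (range (exit_rate (queue_rates \<alpha> l m)))"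
    by (intro bdd_aboveI[of _ "L + M + C"]) auto
qed

lemma drift_queue_rates:
  assumes "bounded_rates \<alpha>" and "(\<lambda>i'. \<alpha> i i' * g (i', q)) summable_on -{i}"
  shows "(\<lambda>y. queue_rates \<alpha> l m (i, q) y * g y) summable_on -{(i, q)}"
    and "drift (queue_rates \<alpha> l m) g (i, q) = l i * (g (i, q + 1) - g (i, q))
        + (if q > 0 then m i * (g (i, q - 1) - g (i, q)) else 0) + drift \<alpha> (\<lambda>i'. g (i', q)) i"
proof -
  note * = has_sum_queue_rates[where \<alpha>=\<alpha> and i=i and q=q and g=g and l=l and m=m, OF assms(2)]
  show "(\<lambda>y. queue_rates \<alpha> l m (i, q) y * g y) summable_on -{(i, q)}"
    using * by (rule has_sum_imp_summable)
  show "drift (queue_rates \<alpha> l m) g (i, q) = l i * (g (i, q + 1) - g (i, q))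
        + (if q > 0 then m i * (g (i, q - 1) - g (i, q)) else 0) + drift \<alpha> (\<lambda>i'. g (i', q)) i"
    unfolding drift_def infsumI[OF *] exit_rate_queue_rates[OF assms(1)]
    by (simp add: algebra_simps)
qed

lemma drift_indicator: "drift \<alpha> (indicat_real {j}) i = generator \<alpha> i j"
proof (cases "i = j")
  case True
  have "(\<Sum>\<^sub>\<infinity>k\<in>-{i}. \<alpha> i k * indicat_real {j} k) = 0"
    by (rule infsum_0) (use True in auto)
  then show ?thesis using True by (simp add: drift_def generator_def)
next
  case False
  have "((\<lambda>k. \<alpha> i k * indicat_real {j} k) has_sum \<alpha> i j) (-{i})"
    by (rule has_sum_finite_neutralI[of "{j}"]) (use False in auto)
  then show ?thesis using False by (simp add: drift_def generator_def infsumI)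
qed

text \<open>Arrivals and services do not affect a function of the modulating state alone, so its
  drift under the queue is its drift under \<open>\<alpha>\<close>. Indicators of states then give
  the balance equations of \<open>\<alpha>\<close> for the marginal.\<close>

lemma queue_marginal:
  assumes \<alpha>: "bounded_rates \<alpha>" and P: "ctmc \<alpha> P" "irreducible_chain P" "stationary P p"
    and Q: "bounded_rates (queue_rates \<alpha> l m)" "ctmc (queue_rates \<alpha> l m) PQ" "stationary PQ pq"
  shows "map_pmf fst pq = p"
proof (rule irreducible_stationary_unique[OF P(2) _ P(3)])
  show "stationary P (map_pmf fst pq)"
  proof (rule balance_imp_stationary[OF \<alpha> P(1)])
    fix j
    let ?g = "\<lambda>x :: 'a \<times> nat. indicat_real {j} (fst x)"
    have sum: "(\<lambda>i'. \<alpha> i i' * ?g (i', q)) summable_on -{i}" for i q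
      by (rule has_sum_imp_summable[where S="if i = j then 0 else \<alpha> i j"])
         (rule has_sum_finite_neutralI[of "{j} - {i}"]; auto)
    have "measure_pmf.expectation pq (drift (queue_rates \<alpha> l m) ?g) = 0"
    proof (rule expectation_drift_eq_0(2)[OF Q(1)])
      show "measure_pmf.expectation pq (\<lambda>i. generator (queue_rates \<alpha> l m) i y) = 0" for y
        by (rule stationary_imp_balance[OF Q])
      show "integrable (measure_pmf pq) ?g"
        by (rule integrable_pmf_bounded[where B=1]) auto
      show "(\<lambda>y. queue_rates \<alpha> l m x y * ?g y) summable_on -{x}" for x
        using drift_queue_rates(1)[OF \<alpha>, of "fst x" ?g "snd x"] sum by simp
    qed
    moreover have "drift (queue_rates \<alpha> l m) ?g = (\<lambda>x. generator \<alpha> (fst x) j)"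
    proof
      fix x :: "'a \<times> nat"
      show "drift (queue_rates \<alpha> l m) ?g x = generator \<alpha> (fst x) j"
        using drift_queue_rates(2)[OF \<alpha>, of "fst x" ?g "snd x" l m] sum by (simp add: drift_indicator)
    qed
    ultimately show "measure_pmf.expectation (map_pmf fst pq) (\<lambda>i. generator \<alpha> i j) = 0"
      by simp
  qed
qed

lemma integrable_bounded_mult_fst:
  fixes V :: "'z \<Rightarrow> real" and c :: "'z \<times> nat \<Rightarrow> real"
  assumes V: "integrable (measure_pmf p) V" and p: "map_pmf fst pq = p"
    and c: "\<And>x. \<bar>c x\<bar> \<le> B"
  shows "integrable (measure_pmf pq) (\<lambda>x. c x * V (fst x))"
proof (rule Bochner_Integration.integrable_bound[where f="\<lambda>x. B * V (fst x)"])
  have "integrable (measure_pmf pq) (\<lambda>x. V (fst x))"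
    using V unfolding p[symmetric] by simp
  then show "integrable (measure_pmf pq) (\<lambda>x. B * V (fst x))" by simp
  have "\<bar>c x\<bar> * \<bar>V (fst x)\<bar> \<le> \<bar>B\<bar> * \<bar>V (fst x)\<bar>" for x
    using c[of x] by (intro mult_right_mono) auto
  then show "AE x in measure_pmf pq. norm (c x * V (fst x)) \<le> norm (B * V (fst x))"
    by (simp add: abs_mult)
qed simp

text \<open>The test function is \<open>exp (- b * q) * V i\<close>: a unit jump of \<open>q\<close>
  multiplies it by \<open>exp (- b)\<close> or \<open>exp b\<close>, so the factor
  \<open>exp (- b * q)\<close> comes out of the whole drift.\<close>

lemma queue_exp_balance:
  fixes \<alpha> :: "'z \<Rightarrow> 'z \<Rightarrow> real" and V :: "'z \<Rightarrow> real"
  assumes \<alpha>: "bounded_rates \<alpha>"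
    and Q: "bounded_rates (queue_rates \<alpha> l m)" "ctmc (queue_rates \<alpha> l m) PQ" "stationary PQ pq"
    and p: "map_pmf fst pq = p" and V: "integrable (measure_pmf p) V"
    and sum: "\<And>i. (\<lambda>i'. \<alpha> i i' * V i') summable_on -{i}" and b: "0 \<le> b"
  shows "measure_pmf.expectation pq (\<lambda>(i, q). exp (- b * real q) *
      (V i * (l i * (exp (- b) - 1) + (if q > 0 then m i * (exp b - 1) else 0)) + drift \<alpha> V i)) = 0"
    (is "measure_pmf.expectation pq ?h = 0")
proof -
  let ?g = "\<lambda>x. exp (- b * real (snd x)) * V (fst x)"
  have s: "(\<lambda>i'. \<alpha> i i' * ?g (i', q)) summable_on -{i}" for i q
    using summable_on_cmult_right[OF sum[of i], of "exp (- b * real q)"] by (simp add: mult_ac)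
  have "measure_pmf.expectation pq (drift (queue_rates \<alpha> l m) ?g) = 0"
  proof (rule expectation_drift_eq_0(2)[OF Q(1)])
    show "measure_pmf.expectation pq (\<lambda>i. generator (queue_rates \<alpha> l m) i y) = 0" for y
      by (rule stationary_imp_balance[OF Q])
    show "integrable (measure_pmf pq) ?g"
      by (rule integrable_bounded_mult_fst[OF V p, where B=1]) (use b in auto)
    show "(\<lambda>y. queue_rates \<alpha> l m x y * ?g y) summable_on -{x}" for x
      using drift_queue_rates(1)[OF \<alpha>, of "fst x" ?g "snd x"] s by simp
  qed
  moreover have "drift (queue_rates \<alpha> l m) ?g = ?h"
  proof
    fix x :: "'z \<times> nat"
    obtain i q where x: "x = (i, q)" by (cases x)
    have "drift \<alpha> (\<lambda>i'. ?g (i', q)) i = exp (- b * real q) * drift \<alpha> V i"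
      using infsum_cmult_right[OF sum[of i], of "exp (- b * real q)"]
      by (simp add: drift_def algebra_simps)
    moreover have "exp (- b * real (q + 1)) = exp (- b * real q) * exp (- b)"
      by (simp add: algebra_simps flip: exp_add)
    \<comment> \<open>Subtraction on naturals truncates, so this needs \<open>q > 0\<close>, exactly
      the case in which service occurs.\<close>
    moreover have "exp (- b * real (q - 1)) = exp (- b * real q) * exp b" if "q > 0"
      using that by (simp add: algebra_simps flip: exp_add)
    ultimately show "drift (queue_rates \<alpha> l m) ?g x = ?h x"
      using drift_queue_rates(2)[OF \<alpha>, of i ?g q l m] s[of i q] x
      by (auto simp: algebra_simps)
  qed
  ultimately show ?thesis by (simp only:)
qed

text \<open>
  Formally this is the drift of \<open>q\<close>, which need not be integrable; instead, divide the balance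
  equation for \<open>exp (- b * q)\<close> by \<open>b\<close> and let \<open>b\<close> tend to 0.
\<close>

lemma expectation_idle_service:
  fixes \<alpha> :: "'z \<Rightarrow> 'z \<Rightarrow> real"
  assumes \<alpha>: "bounded_rates \<alpha>"
    and Q: "bounded_rates (queue_rates \<alpha> l m)" "ctmc (queue_rates \<alpha> l m) PQ" "stationary PQ pq"
    and p: "map_pmf fst pq = p"
    and l: "\<And>i. 0 \<le> l i" "\<And>i. l i \<le> L"
    and m: "\<And>i. 0 \<le> m i" "\<And>i. m i \<le> M"
  shows "measure_pmf.expectation pq (\<lambda>x. if snd x = 0 then m (fst x) else 0)
       = measure_pmf.expectation p m - measure_pmf.expectation p l"
proof -
  let ?u = "\<lambda>b (i, q). exp (- b * real q) * ((if q > 0 then exp b * m i else 0) - l i)"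
  have zero: "measure_pmf.expectation pq (?u b) = 0" if b: "0 < b" for b
  proof -
    have d: "drift \<alpha> (\<lambda>_. 1) i = 0" for i by (simp add: drift_def exit_rate_def)
    \<comment> \<open>For the constant function 1,
      \<open>exp b - 1 = (1 - exp (- b)) * exp b\<close> lets the same factor come out of arrivals
      and services; it is nonzero for \<open>b > 0\<close>.\<close>
    have "measure_pmf.expectation pq (\<lambda>x. (1 - exp (- b)) * ?u b x) = 0"
    proof -
      have "(\<lambda>x. (1 - exp (- b)) * ?u b x) = (\<lambda>(i, q). exp (- b * real q) *
        (1 * (l i * (exp (- b) - 1) + (if q > 0 then m i * (exp b - 1) else 0)) + drift \<alpha> (\<lambda>_. 1) i))"
        by (auto simp: fun_eq_iff d algebra_simps simp flip: exp_add)
      then show ?thesis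
        using queue_exp_balance[OF \<alpha> Q p, of "\<lambda>_. 1" b] \<alpha> b by (simp add: bounded_rates_def)
    qed
    then show ?thesis using b by simp
  qed
  let ?b = "\<lambda>n. 1 / real (Suc n)"
  have "(\<lambda>n. measure_pmf.expectation pq (?u (?b n))) \<longlonglongrightarrow> measure_pmf.expectation pq (?u 0)"
  proof (rule integral_dominated_convergence[where w="\<lambda>_. exp 1 * M + L"])
    have b0: "?b \<longlonglongrightarrow> 0"
      using LIMSEQ_Suc[OF lim_const_over_n[of 1]] by simp
    show "AE x in measure_pmf pq. (\<lambda>n. ?u (?b n) x) \<longlonglongrightarrow> ?u 0 x"
    proof (rule AE_I2, clarify)
      fix i q
      have "((\<lambda>n. exp (- ?b n * real q) * ((if q > 0 then exp (?b n) * m i else 0) - l i)) \<longlonglongrightarrow>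
        exp (- 0 * real q) * ((if q > 0 then exp 0 * m i else 0) - l i))"
        using b0 by (cases "q > 0") (simp_all only: if_True if_False, (intro tendsto_intros b0)+)
      then show "(\<lambda>n. exp (- ?b n * real q) * ((if q > 0 then exp (?b n) * m i else 0) - l i)) \<longlonglongrightarrow>
        exp (- 0 * real q) * ((if q > 0 then exp 0 * m i else 0) - l i)" .
    qed
    show "AE x in measure_pmf pq. norm (?u (?b n) x) \<le> exp 1 * M + L" for n
    proof (rule AE_I2, clarify)
      fix i q
      define b where "b = ?b n"
      have b: "0 \<le> b" "b \<le> 1" by (simp_all add: b_def)
      have 1: "\<bar>exp (- b * real q)\<bar> \<le> 1" using b by simp
      have "exp b * m i \<le> exp 1 * M" using b m[of i] by (intro mult_mono) auto
      moreover have "0 \<le> exp b * m i" "0 \<le> exp 1 * M" using m[of i] by auto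
      ultimately have 2: "\<bar>(if q > 0 then exp b * m i else 0) - l i\<bar> \<le> exp 1 * M + L"
        using l[of i] by auto
      have "\<bar>exp (- b * real q)\<bar> * \<bar>(if q > 0 then exp b * m i else 0) - l i\<bar> \<le> 1 * (exp 1 * M + L)"
        using 1 2 by (intro mult_mono) auto
      then show "norm (exp (- ?b n * real q) * ((if q > 0 then exp (?b n) * m i else 0) - l i)) \<le> exp 1 * M + L"
        by (simp only: b_def real_norm_def abs_mult mult_1)
    qed
  qed auto
  moreover have "measure_pmf.expectation pq (?u (?b n)) = 0" for n
    by (rule zero) simp
  ultimately have "(\<lambda>n. 0) \<longlonglongrightarrow> measure_pmf.expectation pq (?u 0)"
    by (simp only:)
  then have "measure_pmf.expectation pq (?u 0) = 0"
    by (rule LIMSEQ_unique[OF _ tendsto_const])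
  moreover have "?u 0 = (\<lambda>x. m (fst x) - l (fst x) - (if snd x = 0 then m (fst x) else 0))"
    by auto
  moreover have "integrable (measure_pmf pq) (\<lambda>x. m (fst x))"
    by (rule integrable_pmf_bounded[where B=M]) (use m in auto)
  moreover have "integrable (measure_pmf pq) (\<lambda>x. l (fst x))"
    by (rule integrable_pmf_bounded[where B=L]) (use l in auto)
  moreover have "integrable (measure_pmf pq) (\<lambda>x. if snd x = 0 then m (fst x) else 0)"
    using m order_trans[OF m] by (intro integrable_pmf_bounded[where B=M]) auto
  ultimately show ?thesis by (simp add: p[symmetric])
qed

section \<open>Covariance\<close>

text \<open>Multiplying the Poisson equation by the exit rate gives the claim, except at an
  absorbing state.\<close>

lemma poisson_solution_drift:
  assumes \<alpha>: "bounded_rates \<alpha>" and P: "ctmc \<alpha> P" "irreducible_chain P" "stationary P p"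
    and V: "poisson_solution \<alpha> p f V"
  shows "(\<lambda>i'. \<alpha> i i' * V i') summable_on -{i}"
    and "drift \<alpha> V i = measure_pmf.expectation p f - f i"
proof -
  let ?e = "exit_rate \<alpha> i" and ?E = "measure_pmf.expectation p f"
  have s: "(\<lambda>i'. \<alpha> i i' / ?e * V i') summable_on -{i}"
    and eq: "V i = (f i - ?E) / ?e + (\<Sum>\<^sub>\<infinity>i'\<in>-{i}. \<alpha> i i' / ?e * V i')"
    using V unfolding poisson_solution_def by blast+
  have "(\<lambda>i'. \<alpha> i i' * V i') summable_on -{i} \<and> drift \<alpha> V i = ?E - f i"
  proof (cases "?e = 0")
    \<comment> \<open>Division by zero yields 0, so the equation says nothing about
      \<open>f i\<close> here. But the point mass at \<open>i\<close> is stationary, so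
      \<open>p\<close> is that point mass and the mean of \<open>f\<close> is
      \<open>f i\<close>.\<close>
    case True
    have "\<alpha> i j = 0" if "j \<noteq> i" for j
      using bounded_rates_le_exit_rate[OF \<alpha>, of i j] bounded_rates_nonneg[OF \<alpha>, of i j] that True by simp
    then have z: "\<alpha> i j * V j = 0" if "j \<in> -{i}" for j using that by simp
    have "measure_pmf.expectation (return_pmf i) (\<lambda>i. generator \<alpha> i j) = 0" for j
      using abs_generator_le[OF \<alpha>, of i j] True by simp
    then have "stationary P (return_pmf i)" by (rule balance_imp_stationary[OF \<alpha> P(1)])
    then have "p = return_pmf i" using irreducible_stationary_unique P(2,3) by blast
    then have "?E = f i" by simp
    moreover have "(\<lambda>i'. \<alpha> i i' * V i') summable_on -{i}"
      using z summable_on_cong[of "-{i}" "\<lambda>j. \<alpha> i j * V j" "\<lambda>_. 0"] by simp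
    ultimately show ?thesis using True infsum_0[of "-{i}" "\<lambda>j. \<alpha> i j * V j", OF z]
      by (simp add: drift_def)
  next
    case False
    have *: "(\<lambda>i'. \<alpha> i i' * V i') = (\<lambda>i'. ?e * (\<alpha> i i' / ?e * V i'))"
      using False by simp
    have "(\<lambda>i'. \<alpha> i i' * V i') summable_on -{i}"
      unfolding * by (rule summable_on_cmult_right[OF s])
    moreover have "(\<Sum>\<^sub>\<infinity>i'\<in>-{i}. \<alpha> i i' * V i') = ?e * (\<Sum>\<^sub>\<infinity>i'\<in>-{i}. \<alpha> i i' / ?e * V i')"
      unfolding * by (rule infsum_cmult_right[OF s])
    moreover have "?e * V i = f i - ?E + ?e * (\<Sum>\<^sub>\<infinity>i'\<in>-{i}. \<alpha> i i' / ?e * V i')"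
      using False by (subst eq) (simp add: distrib_left)
    ultimately show ?thesis by (simp add: drift_def)
  qed
  then show "(\<lambda>i'. \<alpha> i i' * V i') summable_on -{i}" and "drift \<alpha> V i = ?E - f i" by auto
qed

lemma covariance_eq:
  assumes "integrable (measure_pmf P) X" and "integrable (measure_pmf P) Y"
    and "integrable (measure_pmf P) (\<lambda>x. X x * Y x)"
  shows "covariance P X Y = measure_pmf.expectation P (\<lambda>x. X x * (Y x - measure_pmf.expectation P Y))"
  unfolding covariance_def
  using assms by (simp add: left_diff_distrib right_diff_distrib)

text \<open>Splitting at level \<open>a\<close>: beyond it, the factor
  \<open>(\<bar>v\<bar> / a) powr \<xi>\<close> is at least 1.\<close>

lemma abs_le_add_powr:
  fixes a v \<xi> :: real
  assumes a: "0 < a" and \<xi>: "0 < \<xi>"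
  shows "\<bar>v\<bar> \<le> a + a powr (- \<xi>) * \<bar>v\<bar> powr (1 + \<xi>)"
proof (cases "\<bar>v\<bar> \<le> a")
  case True
  then show ?thesis by (smt (verit) mult_nonneg_nonneg powr_ge_zero)
next
  case False
  then have "1 = a powr (- \<xi>) * a powr \<xi>" using a by (simp flip: powr_add)
  also have "\<dots> \<le> a powr (- \<xi>) * \<bar>v\<bar> powr \<xi>"
    using False a \<xi> by (intro mult_left_mono powr_mono2) auto
  finally have "\<bar>v\<bar> * 1 \<le> \<bar>v\<bar> * (a powr (- \<xi>) * \<bar>v\<bar> powr \<xi>)"
    by (intro mult_left_mono) auto
  also have "\<dots> = a powr (- \<xi>) * \<bar>v\<bar> powr (1 + \<xi>)"
    using False a by (simp add: powr_add)
  finally show ?thesis using a by simp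
qed

text \<open>Shows at once that the left side is nonnegative and of second order in
  \<open>b\<close>.\<close>

lemma exp_add_exp_minus: "exp b + exp (- b) - 2 = exp (- b) * (exp b - 1)\<^sup>2" for b :: real
  by (simp add: power2_eq_square algebra_simps flip: exp_add)

lemma exp_minus_one_bounds:
  fixes b :: real
  assumes "0 \<le> b" "b \<le> 1"
  shows "exp b - 1 \<le> 2 * b" and "exp b + exp (- b) - 2 \<le> 4 * b\<^sup>2"
proof -
  have 1: "0 \<le> exp b - 1" using assms by simp
  have "b\<^sup>2 \<le> b" using assms by (simp add: power2_eq_square mult_left_le)
  then show 2: "exp b - 1 \<le> 2 * b" using exp_bound[OF assms] by simp
  have "exp (- b) * (exp b - 1)\<^sup>2 \<le> 1 * (2 * b)\<^sup>2"
    using assms 1 2 by (intro mult_mono power_mono) auto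
  then show "exp b + exp (- b) - 2 \<le> 4 * b\<^sup>2"
    unfolding exp_add_exp_minus by (simp add: power_mult_distrib)
qed

text \<open>
  The free parameter \<open>a\<close> stands in for Hoelder's inequality, which is recovered by optimizing
  over it; the theorem takes \<open>a = \<epsilon> powr (- 1 / (1 + \<xi>))\<close>.
\<close>

lemma queue_covariance_remainder:
  fixes \<alpha> :: "'z \<Rightarrow> 'z \<Rightarrow> real" and V f :: "'z \<Rightarrow> real"
  assumes \<alpha>: "bounded_rates \<alpha>" and P: "ctmc \<alpha> P" "irreducible_chain P" "stationary P p"
    and PQ: "ctmc (queue_rates \<alpha> l m) PQ" "stationary PQ pq"
    and l: "\<And>i. 0 \<le> l i" "\<And>i. l i \<le> L"
    and m: "\<And>i. 0 \<le> m i" "\<And>i. m i \<le> M"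
    and pois: "poisson_solution \<alpha> p f V"
    and \<xi>: "0 < \<xi>" and int: "integrable (measure_pmf p) (\<lambda>i. \<bar>V i\<bar> powr (1 + \<xi>))"
    and b: "0 \<le> b" and a: "0 < a"
  shows "\<bar>covariance pq (\<lambda>(i, q). exp (- b * real q)) (\<lambda>(i, q). f i)
      - (exp (- b) - 1) * measure_pmf.expectation pq (\<lambda>(i, q). exp (- b * real q) * V i * (l i - m i))\<bar>
    \<le> (exp b + exp (- b) - 2) * (M * measure_pmf.expectation p (\<lambda>i. \<bar>V i\<bar>))
      + (exp b - 1) * (a * (measure_pmf.expectation p m - measure_pmf.expectation p l)
          + a powr (- \<xi>) * (M * measure_pmf.expectation p (\<lambda>i. \<bar>V i\<bar> powr (1 + \<xi>))))"
proof -
  note Q = bounded_rates_queue_rates[OF \<alpha> l m] PQ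
  have p: "map_pmf fst pq = p" by (rule queue_marginal[OF \<alpha> P Q])
  note V = poisson_solution_drift[OF \<alpha> P pois]
  \<comment> \<open>Splitting at level 1 turns the moment of order \<open>1 + \<xi>\<close> into
    integrability.\<close>
  have iV: "integrable (measure_pmf p) V"
  proof (rule Bochner_Integration.integrable_bound)
    show "integrable (measure_pmf p) (\<lambda>i. 1 + \<bar>V i\<bar> powr (1 + \<xi>))" using int by simp
    show "AE i in measure_pmf p. norm (V i) \<le> norm (1 + \<bar>V i\<bar> powr (1 + \<xi>))"
      using abs_le_add_powr[OF zero_less_one \<xi>] by simp
  qed simp
  have jf: "integrable (measure_pmf p) f"
    using pois unfolding poisson_solution_def by blast
  note iVc = integrable_bounded_mult_fst[OF iV p] and ifc = integrable_bounded_mult_fst[OF jf p]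
  have M0: "0 \<le> M" using m order_trans by blast
  let ?X = "\<lambda>x :: 'z \<times> nat. exp (- b * real (snd x))"
  have X: "0 \<le> ?X x" "?X x \<le> 1" for x using b by auto
  have Xc: "\<bar>?X x * c\<bar> \<le> \<bar>c\<bar>" for x c
    using mult_right_mono[OF X(2)[of x], of "\<bar>c\<bar>"] by (simp add: abs_mult)
  let ?E = "measure_pmf.expectation"
  have Ef: "?E pq (\<lambda>x. f (fst x)) = ?E p f" by (simp add: p[symmetric])
  have cov: "covariance pq (\<lambda>(i, q). exp (- b * real q)) (\<lambda>(i, q). f i)
      = ?E pq (\<lambda>x. ?X x * (f (fst x) - ?E p f))"
    unfolding Ef[symmetric] case_prod_beta
  proof (rule covariance_eq)
    show "integrable (measure_pmf pq) ?X"
      by (rule integrable_pmf_bounded[where B=1]) (use X in auto)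
    show "integrable (measure_pmf pq) (\<lambda>x. f (fst x))"
      using ifc[of "\<lambda>_. 1" 1] by simp
    show "integrable (measure_pmf pq) (\<lambda>x. ?X x * f (fst x))"
      by (rule ifc[of _ 1]) (use X in auto)
  qed
  have iXf: "integrable (measure_pmf pq) (\<lambda>x. ?X x * (f (fst x) - ?E p f))"
  proof -
    have "integrable (measure_pmf pq) (\<lambda>x. ?X x * f (fst x))"
      by (rule ifc[of _ 1]) (use X in auto)
    moreover have "integrable (measure_pmf pq) ?X"
      by (rule integrable_pmf_bounded[where B=1]) (use X in auto)
    ultimately show ?thesis by (simp add: right_diff_distrib)
  qed
  let ?c = "\<lambda>x. l (fst x) * (exp (- b) - 1) + (if snd x > 0 then m (fst x) * (exp b - 1) else 0)"
  have "\<bar>?X x * ?c x\<bar> \<le> L * \<bar>exp (- b) - 1\<bar> + M * \<bar>exp b - 1\<bar>" for x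
  proof -
    have "\<bar>l (fst x) * (exp (- b) - 1)\<bar> \<le> L * \<bar>exp (- b) - 1\<bar>"
      unfolding abs_mult using l by (intro mult_right_mono) auto
    moreover have "\<bar>m (fst x) * (exp b - 1)\<bar> \<le> M * \<bar>exp b - 1\<bar>"
      unfolding abs_mult using m by (intro mult_right_mono) auto
    moreover have "0 \<le> M * \<bar>exp b - 1\<bar>" using M0 by simp
    ultimately have "\<bar>?c x\<bar> \<le> L * \<bar>exp (- b) - 1\<bar> + M * \<bar>exp b - 1\<bar>" by (simp split: if_split) linarith+
    then show ?thesis using Xc[of x "?c x"] by linarith
  qed
  then have iXc: "integrable (measure_pmf pq) (\<lambda>x. ?X x * ?c x * V (fst x))"
    by (rule iVc)
  have "(\<lambda>x. ?X x * ?c x * V (fst x) - ?X x * (f (fst x) - ?E p f)) = (\<lambda>(i, q). exp (- b * real q) *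
      (V i * (l i * (exp (- b) - 1) + (if q > 0 then m i * (exp b - 1) else 0)) + drift \<alpha> V i))"
    by (auto simp: fun_eq_iff V(2) algebra_simps)
  then have "?E pq (\<lambda>x. ?X x * ?c x * V (fst x) - ?X x * (f (fst x) - ?E p f)) = 0"
    using queue_exp_balance[OF \<alpha> Q p iV V(1) b] by (simp only:)
  then have cov': "?E pq (\<lambda>x. ?X x * (f (fst x) - ?E p f)) = ?E pq (\<lambda>x. ?X x * ?c x * V (fst x))"
    using iXf iXc by simp
  have "\<bar>?X x * (l (fst x) - m (fst x))\<bar> \<le> L + M" for x
    using Xc[of x "l (fst x) - m (fst x)"] l[of "fst x"] m[of "fst x"] by linarith
  then have iXlm: "integrable (measure_pmf pq) (\<lambda>x. ?X x * (l (fst x) - m (fst x)) * V (fst x))"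
    by (rule iVc)
  let ?c1 = "exp b - 1" and ?c2 = "exp b + exp (- b) - 2"
  have c1: "0 \<le> ?c1" using b by simp
  have c2: "0 \<le> ?c2" by (simp add: exp_add_exp_minus)
  let ?I = "\<lambda>x. if snd x = 0 then m (fst x) else 0"
  \<comment> \<open>The arrival terms cancel in \<open>?R\<close>. What remains is
    \<open>?c2 * m\<close> from pretending that service always occurs, minus \<open>?c1 * m\<close>
    at \<open>q = 0\<close> to correct for it, both times \<open>exp (- b * q) * V\<close>.\<close>
  let ?R = "\<lambda>x. ?X x * ?c x * V (fst x) - (exp (- b) - 1) * (?X x * (l (fst x) - m (fst x)) * V (fst x))"
  let ?B = "\<lambda>x. ?c2 * (M * \<bar>V (fst x)\<bar>) + ?c1 * (a * ?I x + a powr (- \<xi>) * (M * \<bar>V (fst x)\<bar> powr (1 + \<xi>)))"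
  have iI: "integrable (measure_pmf pq) ?I"
    by (rule integrable_pmf_bounded[where B=M]) (use m M0 in auto)
  have EI: "?E pq ?I = ?E p m - ?E p l"
    by (rule expectation_idle_service[OF \<alpha> Q p l m])
  have iA: "integrable (measure_pmf pq) (\<lambda>x. \<bar>V (fst x)\<bar>)"
    and iW: "integrable (measure_pmf pq) (\<lambda>x. \<bar>V (fst x)\<bar> powr (1 + \<xi>))"
    using iV int unfolding p[symmetric] by simp_all
  have iR: "integrable (measure_pmf pq) ?R" using iXc iXlm by simp
  have iB: "integrable (measure_pmf pq) ?B" using iI iA iW by simp
  have le: "\<bar>?R x\<bar> \<le> ?B x" for x
  proof -
    let ?v = "V (fst x)" and ?m = "m (fst x)"
    have "?R x = ?X x * ((?c2 * ?m - ?c1 * ?I x) * ?v)"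
      by (simp add: algebra_simps)
    also have "\<bar>\<dots>\<bar> \<le> \<bar>(?c2 * ?m - ?c1 * ?I x) * ?v\<bar>" by (rule Xc)
    also have "\<dots> = \<bar>?c2 * ?m - ?c1 * ?I x\<bar> * \<bar>?v\<bar>" by (rule abs_mult)
    also have "\<dots> \<le> (?c2 * ?m + ?c1 * ?I x) * \<bar>?v\<bar>"
    proof (rule mult_right_mono)
      have "0 \<le> ?c2 * ?m" "0 \<le> ?c1 * ?I x" using c1 c2 m by (auto intro!: mult_nonneg_nonneg)
      then show "\<bar>?c2 * ?m - ?c1 * ?I x\<bar> \<le> ?c2 * ?m + ?c1 * ?I x" by linarith
    qed simp
    also have "\<dots> = ?c2 * (?m * \<bar>?v\<bar>) + ?c1 * (?I x * \<bar>?v\<bar>)" by (simp add: algebra_simps)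
    also have "\<dots> \<le> ?B x"
    proof (intro add_mono mult_left_mono c1 c2)
      show "?m * \<bar>?v\<bar> \<le> M * \<bar>?v\<bar>" using m by (intro mult_right_mono) auto
      have I: "0 \<le> ?I x" "?I x \<le> M" using m M0 by auto
      \<comment> \<open>\<open>?I\<close> is kept in the \<open>a\<close> term, where its mean is
        small in heavy traffic, and bounded by \<open>M\<close> only next to the moment of
        \<open>V\<close>.\<close>
      have "?I x * \<bar>?v\<bar> \<le> ?I x * (a + a powr (- \<xi>) * \<bar>?v\<bar> powr (1 + \<xi>))"
        by (rule mult_left_mono[OF abs_le_add_powr[OF a \<xi>] I(1)])
      also have "\<dots> = a * ?I x + a powr (- \<xi>) * (?I x * \<bar>?v\<bar> powr (1 + \<xi>))"
        by (simp only: distrib_left mult_ac)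
      also have "\<dots> \<le> a * ?I x + a powr (- \<xi>) * (M * \<bar>?v\<bar> powr (1 + \<xi>))"
        by (intro add_left_mono mult_left_mono mult_right_mono I) auto
      finally show "?I x * \<bar>?v\<bar> \<le> a * ?I x + a powr (- \<xi>) * (M * \<bar>?v\<bar> powr (1 + \<xi>))" .
    qed
    finally show ?thesis .
  qed
  have "?E pq (\<lambda>(i, q). exp (- b * real q) * V i * (l i - m i))
      = ?E pq (\<lambda>x. ?X x * (l (fst x) - m (fst x)) * V (fst x))"
    by (rule Bochner_Integration.integral_cong) auto
  then have "covariance pq (\<lambda>(i, q). exp (- b * real q)) (\<lambda>(i, q). f i)
      - (exp (- b) - 1) * ?E pq (\<lambda>(i, q). exp (- b * real q) * V i * (l i - m i)) = ?E pq ?R"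
    unfolding cov cov' using iXc iXlm by simp
  moreover have "\<bar>?E pq ?R\<bar> \<le> ?E pq ?B"
  proof -
    have "\<bar>?E pq ?R\<bar> \<le> ?E pq (\<lambda>x. \<bar>?R x\<bar>)" by (rule integral_abs_bound)
    also have "\<dots> \<le> ?E pq ?B" using iR iB le by (intro integral_mono integrable_abs) auto
    finally show ?thesis .
  qed
  moreover have "?E pq ?B = ?c2 * (M * ?E p (\<lambda>i. \<bar>V i\<bar>)) + ?c1 * (a * (?E p m - ?E p l)
          + a powr (- \<xi>) * (M * ?E p (\<lambda>i. \<bar>V i\<bar> powr (1 + \<xi>))))"
  proof -
    have "?E pq (\<lambda>x. \<bar>V (fst x)\<bar>) = ?E p (\<lambda>i. \<bar>V i\<bar>)"
      and "?E pq (\<lambda>x. \<bar>V (fst x)\<bar> powr (1 + \<xi>)) = ?E p (\<lambda>i. \<bar>V i\<bar> powr (1 + \<xi>))"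
      by (simp_all add: p[symmetric])
    then show ?thesis using iI iA iW by (simp add: EI)
  qed
  ultimately show ?thesis by (simp only:)
qed

theorem theorem2:
  fixes \<alpha> :: "'z::countable \<Rightarrow> 'z \<Rightarrow> real"
    and P :: "real \<Rightarrow> 'z \<Rightarrow> 'z pmf"
    and p :: "'z pmf"
    and mu :: "'z \<Rightarrow> real"
    and lam :: "real \<Rightarrow> 'z \<Rightarrow> real"
    and lam_max mu_max eps0 :: real
    and PQ :: "real \<Rightarrow> real \<Rightarrow> 'z \<times> nat \<Rightarrow> ('z \<times> nat) pmf"
    and pq :: "real \<Rightarrow> ('z \<times> nat) pmf"
    and f V :: "'z \<Rightarrow> real"
    and \<xi> s :: real
  assumes "bounded_rates \<alpha>" and "ctmc \<alpha> P" and "ergodic P" and "stationary P p"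
    and "\<And>i. 0 \<le> mu i" and "\<And>i. mu i < mu_max"
    and "0 < measure_pmf.expectation p mu"
    and "0 < eps0"
    and "\<And>\<epsilon> i. 0 < \<epsilon> \<Longrightarrow> \<epsilon> < eps0 \<Longrightarrow> 0 \<le> lam \<epsilon> i"
    and "\<And>\<epsilon> i. 0 < \<epsilon> \<Longrightarrow> \<epsilon> < eps0 \<Longrightarrow> lam \<epsilon> i < lam_max"
    and "\<And>\<epsilon>. 0 < \<epsilon> \<Longrightarrow> \<epsilon> < eps0 \<Longrightarrow>
           \<epsilon> = 1 - measure_pmf.expectation p (lam \<epsilon>) / measure_pmf.expectation p mu"
    and "\<And>\<epsilon>. 0 < \<epsilon> \<Longrightarrow> \<epsilon> < eps0 \<Longrightarrow> ctmc (queue_rates \<alpha> (lam \<epsilon>) mu) (PQ \<epsilon>)"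
    and "\<And>\<epsilon>. 0 < \<epsilon> \<Longrightarrow> \<epsilon> < eps0 \<Longrightarrow> positive_recurrent (PQ \<epsilon>)"
    and "\<And>\<epsilon>. 0 < \<epsilon> \<Longrightarrow> \<epsilon> < eps0 \<Longrightarrow> stationary (PQ \<epsilon>) (pq \<epsilon>)"
    and "poisson_solution \<alpha> p f V"
    and "0 < \<xi>"
    and "integrable (measure_pmf p) (\<lambda>i. \<bar>V i\<bar> powr (1 + \<xi>))"
    and "0 < s"
  shows "(\<lambda>\<epsilon>. covariance (pq \<epsilon>) (\<lambda>(i, q). exp (- s * \<epsilon> * real q)) (\<lambda>(i, q). f i)
              - (exp (- s * \<epsilon>) - 1) *
                measure_pmf.expectation (pq \<epsilon>)
                  (\<lambda>(i, q). exp (- s * \<epsilon> * real q) * V i * (lam \<epsilon> i - mu i)))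
         \<in> O[at_right 0](\<lambda>\<epsilon>. \<epsilon> powr (2 - 1 / (1 + \<xi>)))"
proof (rule bigoI)
  let ?E = "measure_pmf.expectation"
  let ?A = "?E p (\<lambda>i. \<bar>V i\<bar>)" and ?B = "?E p (\<lambda>i. \<bar>V i\<bar> powr (1 + \<xi>))"
  let ?C = "4 * s\<^sup>2 * (mu_max * ?A) + 2 * s * (?E p mu + mu_max * ?B)"
  let ?F = "\<lambda>\<epsilon>. covariance (pq \<epsilon>) (\<lambda>(i, q). exp (- s * \<epsilon> * real q)) (\<lambda>(i, q). f i)
              - (exp (- s * \<epsilon>) - 1) * ?E (pq \<epsilon>) (\<lambda>(i, q). exp (- s * \<epsilon> * real q) * V i * (lam \<epsilon> i - mu i))"
  have M0: "0 \<le> mu_max" using assms(5,6) by (meson less_imp_le order_trans)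
  have A0: "0 \<le> ?A" and B0: "0 \<le> ?B" by (simp_all add: integral_nonneg)
  have irr: "irreducible_chain P" using assms(3) by (simp add: ergodic_def)
  \<comment> \<open>The bound 1 gives \<open>\<epsilon> \<le> d\<close> below, and
    \<open>1 / s\<close> gives \<open>s * \<epsilon> \<le> 1\<close> for the exponential
    estimates.\<close>
  have "\<forall>\<^sub>F \<epsilon> in at_right 0. \<epsilon> \<in> {0<..<min eps0 (min 1 (1 / s))}"
    using assms(8,18) by (intro eventually_at_right_real) simp
  then show "\<forall>\<^sub>F \<epsilon> in at_right 0. norm (?F \<epsilon>) \<le> ?C * norm (\<epsilon> powr (2 - 1 / (1 + \<xi>)))"
  proof eventually_elim
    case (elim \<epsilon>)
    then have e: "0 < \<epsilon>" "\<epsilon> < eps0" and e1: "\<epsilon> \<le> 1" and es: "s * \<epsilon> \<le> 1"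
      using assms(18) by (auto simp: field_simps)
    have b: "0 \<le> s * \<epsilon>" using e assms(18) by simp
    \<comment> \<open>This level makes \<open>a * \<epsilon>\<close> and
      \<open>a powr (- \<xi>)\<close> equal; \<open>d\<close> is their common value.\<close>
    define a where "a = \<epsilon> powr (- 1 / (1 + \<xi>))"
    have a: "0 < a" using e by (simp add: a_def)
    define d where "d = \<epsilon> powr (\<xi> / (1 + \<xi>))"
    have d0: "0 \<le> d" by (simp add: d_def)
    have "a * \<epsilon> = \<epsilon> powr (- 1 / (1 + \<xi>) + 1)"
      using e unfolding a_def powr_add by simp
    also have "- 1 / (1 + \<xi>) + 1 = \<xi> / (1 + \<xi>)" using assms(16) by (simp add: field_simps)
    finally have ae: "a * \<epsilon> = d" by (simp add: d_def)
    have ax: "a powr (- \<xi>) = d" by (simp add: a_def d_def powr_powr)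
    have rate: "\<epsilon> powr (2 - 1 / (1 + \<xi>)) = \<epsilon> * d"
    proof -
      have "2 - 1 / (1 + \<xi>) = 1 + \<xi> / (1 + \<xi>)" using assms(16) by (simp add: field_simps)
      then have "\<epsilon> powr (2 - 1 / (1 + \<xi>)) = \<epsilon> powr (1 + \<xi> / (1 + \<xi>))" by (simp only:)
      then show ?thesis using e by (simp add: powr_add d_def)
    qed
    \<comment> \<open>Absorbs the second-order term, a multiple of
      \<open>\<epsilon> * \<epsilon>\<close>, into the rate \<open>\<epsilon> * d\<close>.\<close>
    have ed: "\<epsilon> \<le> d"
    proof -
      have "\<epsilon> powr 1 \<le> \<epsilon> powr (\<xi> / (1 + \<xi>))"
        using e e1 assms(16) by (intro powr_mono') auto
      then show ?thesis using e by (simp add: d_def)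
    qed
    have idle: "?E p mu - ?E p (lam \<epsilon>) = \<epsilon> * ?E p mu"
      using assms(11)[OF e] assms(7) by (simp add: field_simps)
    have "\<bar>?F \<epsilon>\<bar> \<le> (exp (s * \<epsilon>) + exp (- (s * \<epsilon>)) - 2) * (mu_max * ?A)
      + (exp (s * \<epsilon>) - 1) * (a * (?E p mu - ?E p (lam \<epsilon>)) + a powr (- \<xi>) * (mu_max * ?B))"
      using queue_covariance_remainder[OF assms(1,2) irr assms(4) assms(12)[OF e] assms(14)[OF e]
          assms(9)[OF e] less_imp_le[OF assms(10)[OF e]] assms(5) less_imp_le[OF assms(6)] assms(15-17) b a]
      by simp
    also have "\<dots> = (exp (s * \<epsilon>) + exp (- (s * \<epsilon>)) - 2) * (mu_max * ?A)
      + (exp (s * \<epsilon>) - 1) * (d * (?E p mu + mu_max * ?B))"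
      unfolding idle ax by (simp add: ae distrib_left flip: mult.assoc)
    also have "\<dots> \<le> 4 * (s * \<epsilon>)\<^sup>2 * (mu_max * ?A) + 2 * (s * \<epsilon>) * (d * (?E p mu + mu_max * ?B))"
      using exp_minus_one_bounds[OF b es] M0 A0 B0 d0 assms(7)
      by (intro add_mono mult_right_mono) auto
    also have "\<dots> = (4 * s\<^sup>2 * (mu_max * ?A)) * (\<epsilon> * \<epsilon>) + 2 * s * (?E p mu + mu_max * ?B) * (\<epsilon> * d)"
      by (simp add: power2_eq_square algebra_simps)
    also have "\<dots> \<le> (4 * s\<^sup>2 * (mu_max * ?A)) * (\<epsilon> * d) + 2 * s * (?E p mu + mu_max * ?B) * (\<epsilon> * d)"
      using M0 A0 e ed by (intro add_right_mono mult_left_mono) auto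
    also have "\<dots> = ?C * (\<epsilon> * d)" by (simp add: algebra_simps)
    finally show ?case using e d0 by (simp add: rate)
  qed
qed

end
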